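(* Let $k\le n$ be positive integers and let $c>0$ be a constant. Suppose $Y=(Y_1,Y_2,\ldots,Y_n)$ is a random vector in $\mathbf{R}^n$ picked from a distribution such that (i) for $i=1,2,\ldots,k$, $E(Y_i^2\mid Y_1^2+Y_2^2+\cdots+Y_{i-1}^2)$ is a non-increasing function of $Y_1^2+Y_2^2+\cdots+Y_{i-1}^2$; and (ii) for $i=1,\ldots,k$ and every positive even $l\le k$, $E(Y_i^l\mid Y_1^2+Y_2^2+\cdots+Y_{i-1}^2)\le (cl)^{l/2}/n^{l/2}$. Then $\sum_{i=1}^k Y_i^2$ has $N\!\left(0,\frac{k}{n^2}\right)$ tails upto $\frac kn$.
   Context: For positive reals $a,\sigma$, a random variable $X$ is said to have $N(0,\sigma^2)$ tails upto $a$ if there exist positive constants $c_0,c_0'$ such that for all $t\in[0,a]$, $\Pr(|X-EX|\ge t)\le c_0'e^{-c_0t^2/\sigma^2}$. Here $c_0,c_0'$ are independent of $n$ and $k$ (they may depend on the constant $c$ in (ii)), while $a,\sigma$ may depend on $n$. For $i=1$ the sum $Y_1^2+\cdots+Y_{i-1}^2$ is the empty sum $0$. *)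

theory Defs
  imports "HOL-Probability.Probability"
begin

definition partial_sq_sum :: "(nat \<Rightarrow> 'a \<Rightarrow> real) \<Rightarrow> nat \<Rightarrow> 'a \<Rightarrow> real" where
  "partial_sq_sum Y i \<omega> = (\<Sum>j\<in>{1..<i}. (Y j \<omega>)\<^sup>2)"

text \<open>
  Conditioning on a random variable S is conditioning on the sigma-algebra it generates.
  The conditional expectation is the extended nonnegative one: it is used below only for even
  powers, and a bound on it forces integrability. The library's real-valued version would
  return 0, hence satisfy any such bound, wherever the conditional moment is infinite.
\<close>

definition cond_exp_given ::
    "'a measure \<Rightarrow> ('a \<Rightarrow> real) \<Rightarrow> ('a \<Rightarrow> real) \<Rightarrow> 'a \<Rightarrow> ennreal" where
  "cond_exp_given M S f =
     nn_cond_exp M (vimage_algebra (space M) S borel) (\<lambda>\<omega>. ennreal (f \<omega>))"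

text \<open>
  Conditional expectations are only determined almost surely, so being a non-increasing function
  of the partial sum means having a version of the form \<open>g \<circ> S\<close> with g non-increasing; the
  partial sums take values in \<open>{0..}\<close>.
\<close>

definition cond_sq_nonincreasing ::
    "'a measure \<Rightarrow> (nat \<Rightarrow> 'a \<Rightarrow> real) \<Rightarrow> nat \<Rightarrow> bool" where
  "cond_sq_nonincreasing M Y i \<longleftrightarrow>
     (\<exists>g :: real \<Rightarrow> real. antimono_on {0..} g \<and>
        (AE \<omega> in M. cond_exp_given M (partial_sq_sum Y i) (\<lambda>\<omega>. (Y i \<omega>)\<^sup>2) \<omega>
                     = ennreal (g (partial_sq_sum Y i \<omega>))))"

text \<open>
  N(0, v) tails up to a, where v is the variance. The constants are parameters because
  they must be chosen uniformly over the dimension and the distribution.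
\<close>

definition has_normal_tails ::
    "real \<Rightarrow> real \<Rightarrow> 'a measure \<Rightarrow> ('a \<Rightarrow> real) \<Rightarrow> real \<Rightarrow> real \<Rightarrow> bool" where
  "has_normal_tails c\<^sub>0 c\<^sub>0' M X v a \<longleftrightarrow>
     (\<forall>t\<in>{0..a}. measure M {\<omega> \<in> space M. t \<le> \<bar>X \<omega> - integral\<^sup>L M X\<bar>}
                  \<le> c\<^sub>0' * exp (- c\<^sub>0 * t\<^sup>2 / v))"

end

theory Submission
  imports Defs
begin

text \<open>
  Let \<open>S\<close> be a partial sum with mean \<open>s\<close>, let \<open>Z\<close> be the next square with mean \<open>\<mu>\<close>, and let \<open>m\<close> be
  even. Expand the moment of order \<open>m\<close> of \<open>(Z - \<mu>) + (S - s)\<close> binomially. The term linear in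
  \<open>Z - \<mu>\<close> is nonpositive, because \<open>E(Z | S)\<close> is non-increasing and \<open>(S - s)^(m - 1)\<close> is increasing
  in \<open>S\<close>. With \<open>A = 2c/n\<close>, the term of order \<open>l \<ge> 2\<close> is at most \<open>Q^l B^(m - l)\<close>, where \<open>Q\<close> is of order
  \<open>A m\<close> and \<open>B^m\<close> bounds the moment of \<open>S - s\<close>; as long as \<open>B \<ge> 2 Q\<close> these terms form a
  geometric series dominated by \<open>l = 2\<close>. So \<open>B\<^sup>2\<close> grows by \<open>O(A\<^sup>2 m)\<close> in each step, and starting it at
  order \<open>A\<^sup>2 m k\<close> keeps \<open>B \<ge> 2 Q\<close> because \<open>m \<le> k\<close>. After \<open>k\<close> steps the moment is at most
  \<open>(O(m k / n\<^sup>2))^(m / 2)\<close>, and Markov's inequality with \<open>m\<close> of order \<open>t\<^sup>2 n\<^sup>2 / k\<close> gives the tail.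
\<close>

section \<open>Elementary power and moment inequalities\<close>

text \<open>One term of the series of \<open>exp l\<close> gives \<open>l^l / l! \<le> e^l\<close>,
  and \<open>(m choose l) * l! \<le> m^l\<close>. The growth \<open>l^l\<close> of the moment
  hypothesis is thereby absorbed by the binomial coefficient, leaving a pure l-th power.\<close>

lemma binomial_mult_power_self_le:
  "real (m choose l) * real l ^ l \<le> (exp 1 * real m) ^ l"
proof -
  have "(\<Sum>n\<in>{l}. real l^n /\<^sub>R fact n) \<le> (\<Sum>n. real l^n /\<^sub>R fact n)"
    using sums_summable[OF exp_converges[of "real l"]] by (intro sum_le_suminf) auto
  then have *: "real l^l / fact l \<le> exp (real l)"
    using sums_unique[OF exp_converges[of "real l"]] by (simp add: divide_inverse mult.commute)
  have "real (m choose l) * fact l \<le> real m ^ l"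
    using binomial_fact_pow[of m l] by (metis of_nat_fact of_nat_le_iff of_nat_mult of_nat_power)
  then have "real (m choose l) * fact l * (real l^l / fact l) \<le> real m ^ l * exp (real l)"
    using * by (intro mult_mono) auto
  then show ?thesis
    by (simp add: power_mult_distrib exp_of_nat_mult[symmetric] mult.commute)
qed

text \<open>Weighted AM-GM for \<open>a^m\<close> and \<open>1\<close> with weights
  \<open>p/m\<close> and \<open>1 - p/m\<close>.\<close>

lemma power_le_weighted_power:
  fixes a :: real assumes "0 \<le> a" "p \<le> m" "0 < m"
  shows "a ^ p \<le> (real p / real m) * a ^ m + (1 - real p / real m)"
proof (cases "a = 0")
  case True then show ?thesis using assms by (cases "p = 0") (auto simp: power_0_left field_simps)
next
  case False
  then have "(a^m) powr (real p / real m) = a ^ p"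
    using assms by (simp add: powr_realpow[symmetric] powr_powr)
  then show ?thesis using Youngs_inequality_0[of "real p / real m" "1 - real p / real m" "a^m" 1] assms False
    by (simp add: field_simps)
qed

text \<open>The weighted AM-GM bound is applied pointwise to \<open>\<bar>U\<bar> / B\<close> and
  integrated; the normalised moment of order \<open>m\<close> is at most 1, so the two weights add
  up to at most 1.\<close>

lemma (in prob_space) lyapunov_power_bound:
  fixes U :: "'a \<Rightarrow> real"
  assumes [measurable]: "U \<in> borel_measurable M"
    and int: "integrable M (\<lambda>x. \<bar>U x\<bar> ^ m)" and le: "expectation (\<lambda>x. \<bar>U x\<bar> ^ m) \<le> B ^ m"
    and "0 < B" "p \<le> m"
  shows "integrable M (\<lambda>x. \<bar>U x\<bar> ^ p)" "expectation (\<lambda>x. \<bar>U x\<bar> ^ p) \<le> B ^ p"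
proof -
  have "integrable M (\<lambda>x. \<bar>U x\<bar> ^ p) \<and> expectation (\<lambda>x. \<bar>U x\<bar> ^ p) \<le> B ^ p"
  proof (cases "m = 0")
    case True then show ?thesis using assms by (simp add: prob_space)
  next
    case False
    define w where "w = real p / real m"
    have w: "0 \<le> w" "w \<le> 1" using assms False by (auto simp: w_def)
    have pw: "\<bar>U x\<bar> ^ p \<le> B ^ p * (w * (\<bar>U x\<bar> ^ m / B ^ m) + (1 - w))" for x
    proof -
      have "(\<bar>U x\<bar> / B) ^ p \<le> w * (\<bar>U x\<bar> / B) ^ m + (1 - w)"
        unfolding w_def using False assms by (intro power_le_weighted_power) auto
      then show ?thesis using \<open>0 < B\<close> by (simp add: power_divide field_simps)
    qed
    have int': "integrable M (\<lambda>x. B ^ p * (w * (\<bar>U x\<bar> ^ m / B ^ m) + (1 - w)))"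
      using int by auto
    have i: "integrable M (\<lambda>x. \<bar>U x\<bar> ^ p)"
    proof (rule Bochner_Integration.integrable_bound[OF int'])
      have "norm (\<bar>U x\<bar> ^ p) \<le> norm (B ^ p * (w * (\<bar>U x\<bar> ^ m / B ^ m) + (1 - w)))" for x
        using order.trans[OF pw abs_ge_self, of x] unfolding real_norm_def power_abs[symmetric] abs_abs .
      then show "AE x in M. norm (\<bar>U x\<bar> ^ p) \<le> norm (B ^ p * (w * (\<bar>U x\<bar> ^ m / B ^ m) + (1 - w)))"
        by simp
    qed simp
    have "expectation (\<lambda>x. \<bar>U x\<bar> ^ p) \<le> expectation (\<lambda>x. B ^ p * (w * (\<bar>U x\<bar> ^ m / B ^ m) + (1 - w)))"
      by (rule integral_mono[OF i int' pw])
    also have "\<dots> = B ^ p * (w * (expectation (\<lambda>x. \<bar>U x\<bar> ^ m) / B ^ m) + (1 - w))"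
      using int by (simp add: prob_space)
    also have "\<dots> \<le> B ^ p * (w * 1 + (1 - w))"
      using le \<open>0 < B\<close> w by (intro mult_left_mono add_right_mono) auto
    finally show ?thesis using i by simp
  qed
  then show "integrable M (\<lambda>x. \<bar>U x\<bar> ^ p)" "expectation (\<lambda>x. \<bar>U x\<bar> ^ p) \<le> B ^ p" by auto
qed

section \<open>Conditioning on a partial sum\<close>

lemma (in prob_space) sigma_finite_subalgebra_vimage:
  fixes S :: "'a \<Rightarrow> real"
  assumes [measurable]: "S \<in> borel_measurable M"
  shows "sigma_finite_subalgebra M (vimage_algebra (space M) S borel)"
proof -
  have "subalgebra M (vimage_algebra (space M) S borel)"
    unfolding subalgebra_def using sets_image_in_sets[of M "space M" S borel] by simp
  then interpret finite_measure_subalgebra M "vimage_algebra (space M) S borel"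
    by unfold_locales
  show ?thesis by (rule sigma_finite_subalgebra_axioms)
qed

text \<open>The factor \<open>\<phi> (S x)\<close> is measurable for the conditioning sigma-algebra
  and can be moved through the conditional expectation. Working with extended nonnegative integrals
  makes the finite bound yield integrability as well.\<close>

lemma (in prob_space) integral_mult_le_of_cond_exp_given_le:
  fixes S f :: "'a \<Rightarrow> real" and \<phi> :: "real \<Rightarrow> real"
  assumes [measurable]: "S \<in> borel_measurable M" "f \<in> borel_measurable M" "\<phi> \<in> borel_measurable borel"
    and f0: "\<And>x. 0 \<le> f x" and \<phi>0: "\<And>s. 0 \<le> \<phi> s" and "0 \<le> b"
    and le: "AE x in M. cond_exp_given M S f x \<le> ennreal b"
    and int: "integrable M (\<lambda>x. \<phi> (S x))"
  shows "integrable M (\<lambda>x. \<phi> (S x) * f x)"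
    and "expectation (\<lambda>x. \<phi> (S x) * f x) \<le> b * expectation (\<lambda>x. \<phi> (S x))"
proof -
  let ?F = "vimage_algebra (space M) S borel"
  interpret F: sigma_finite_subalgebra M ?F by (rule sigma_finite_subalgebra_vimage) fact
  have [measurable]: "S \<in> borel_measurable ?F" by (rule measurable_vimage_algebra1) auto
  have "(\<integral>\<^sup>+x. ennreal (\<phi> (S x) * f x) \<partial>M) = (\<integral>\<^sup>+x. ennreal (\<phi> (S x)) * ennreal (f x) \<partial>M)"
    using f0 \<phi>0 by (simp add: ennreal_mult)
  also have "\<dots> = (\<integral>\<^sup>+x. ennreal (\<phi> (S x)) * nn_cond_exp M ?F (\<lambda>x. ennreal (f x)) x \<partial>M)"
    by (rule F.nn_cond_exp_intg[symmetric]) measurable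
  also have "\<dots> \<le> (\<integral>\<^sup>+x. ennreal (\<phi> (S x)) * ennreal b \<partial>M)"
    using le by (intro nn_integral_mono_AE) (auto simp: cond_exp_given_def intro!: mult_left_mono)
  also have "\<dots> = ennreal b * (\<integral>\<^sup>+x. ennreal (\<phi> (S x)) \<partial>M)"
    by (subst nn_integral_multc) (auto simp: mult.commute)
  also have "\<dots> = ennreal (b * expectation (\<lambda>x. \<phi> (S x)))"
    using int \<phi>0 \<open>0 \<le> b\<close> by (subst nn_integral_eq_integral) (auto simp: ennreal_mult)
  finally have *: "(\<integral>\<^sup>+x. ennreal (\<phi> (S x) * f x) \<partial>M) \<le> ennreal (b * expectation (\<lambda>x. \<phi> (S x)))" .
  then show i: "integrable M (\<lambda>x. \<phi> (S x) * f x)"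
    using f0 \<phi>0 by (intro integrableI_nonneg) (auto intro: le_less_trans)
  have "0 \<le> b * expectation (\<lambda>x. \<phi> (S x))" using \<phi>0 \<open>0 \<le> b\<close> by (auto intro!: mult_nonneg_nonneg)
  with * show "expectation (\<lambda>x. \<phi> (S x) * f x) \<le> b * expectation (\<lambda>x. \<phi> (S x))"
    using i f0 \<phi>0 by (subst (asm) nn_integral_eq_integral) auto
qed

text \<open>A form of Chebyshev's association inequality. Replace \<open>Z\<close> by its
  conditional expectation \<open>h\<close>, and subtract from \<open>\<phi>\<close> its value at the
  point \<open>u\<close> where \<open>g\<close> crosses the mean: the product becomes pointwise
  nonpositive, and the subtracted constant contributes nothing because \<open>h - \<mu>\<close> has
  mean 0.\<close>

lemma (in prob_space) expectation_mult_centered_nonpos: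
  fixes S Z :: "'a \<Rightarrow> real" and \<phi> g :: "real \<Rightarrow> real"
  assumes [measurable]: "S \<in> borel_measurable M" "Z \<in> borel_measurable M" "\<phi> \<in> borel_measurable borel"
    and S0: "\<And>x. 0 \<le> S x" and Z0: "\<And>x. 0 \<le> Z x"
    and anti: "antimono_on {0..} g"
    and ce: "AE x in M. cond_exp_given M S Z x = ennreal (g (S x))"
    and mono: "mono \<phi>"
    and intZ: "integrable M Z" and int\<phi>: "integrable M (\<lambda>x. \<phi> (S x))"
    and int\<phi>Z: "integrable M (\<lambda>x. \<phi> (S x) * Z x)"
  shows "expectation (\<lambda>x. \<phi> (S x) * (Z x - expectation Z)) \<le> 0"
proof -
  let ?F = "vimage_algebra (space M) S borel"
  interpret F: sigma_finite_subalgebra M ?F by (rule sigma_finite_subalgebra_vimage) fact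
  have [measurable]: "S \<in> borel_measurable ?F" by (rule measurable_vimage_algebra1) auto
  define \<mu> where "\<mu> = expectation Z"
  define h where "h = real_cond_exp M ?F Z"
  have [measurable]: "h \<in> borel_measurable M" unfolding h_def by measurable
  \<comment> \<open>The real conditional expectation is the difference of those of the positive and
    negative parts; the negative part of \<open>Z\<close> is 0.\<close>
  have "AE x in M. 0 = nn_cond_exp M ?F (\<lambda>x. 0) x" by (rule F.nn_cond_exp_F_meas) auto
  \<comment> \<open>The maximum appears because \<open>g\<close> may take negative values, which
    \<open>ennreal\<close> sends to 0.\<close>
  then have hg: "AE x in M. h x = max 0 (g (S x))"
    using ce
  proof eventually_elim
    case (elim x)
    have "ennreal (- Z y) = 0" for y using Z0[of y] by (simp add: ennreal_neg)
    with elim show ?case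
      by (simp add: h_def real_cond_exp_def cond_exp_given_def enn2real_eq_0_iff max_def ennreal_neg)
  qed
  have ih: "integrable M h" and Eh: "expectation h = \<mu>"
    unfolding h_def \<mu>_def using F.real_cond_exp_int[OF intZ] by auto
  have i\<phi>h: "integrable M (\<lambda>x. \<phi> (S x) * h x)"
    and E\<phi>h: "expectation (\<lambda>x. \<phi> (S x) * h x) = expectation (\<lambda>x. \<phi> (S x) * Z x)"
    unfolding h_def using F.real_cond_exp_intg[OF int\<phi>Z] by auto
  have g_anti: "g t \<le> g s" if "0 \<le> s" "s \<le> t" for s t
    using anti that unfolding monotone_on_def by auto
  have "expectation (\<lambda>x. \<phi> (S x) * (Z x - \<mu>)) = expectation (\<lambda>x. \<phi> (S x) * Z x) - \<mu> * expectation (\<lambda>x. \<phi> (S x))"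
    using int\<phi> int\<phi>Z by (simp add: algebra_simps)
  also have "\<dots> = expectation (\<lambda>x. \<phi> (S x) * (h x - \<mu>))"
    using int\<phi> i\<phi>h E\<phi>h by (simp add: algebra_simps)
  finally have eq: "expectation (\<lambda>x. \<phi> (S x) * (Z x - \<mu>)) = expectation (\<lambda>x. \<phi> (S x) * (h x - \<mu>))" .
  \<comment> \<open>Beyond the crossing point this turns \<open>g < \<mu>\<close> into
    \<open>max 0 g \<le> \<mu>\<close>.\<close>
  have \<mu>0: "0 \<le> \<mu>" unfolding \<mu>_def using Z0 by simp
  have "expectation (\<lambda>x. \<phi> (S x) * (h x - \<mu>)) \<le> 0"
  proof (cases "\<forall>s\<ge>0. \<mu> \<le> g s")
    case True
    then have *: "\<mu> \<le> g (S x)" for x using S0[of x] by blast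
    have "AE x in M. \<mu> \<le> h x"
      using hg by eventually_elim (use * in \<open>auto intro: order.trans[OF _ max.cobounded2]\<close>)
    \<comment> \<open>Without a crossing, \<open>h\<close> lies above its own mean and is therefore
      almost surely constant.\<close>
    then have "AE x in M. \<mu> = h x"
      by (intro integral_ineq_eq_0_then_AE) (auto simp: ih Eh prob_space)
    then have "expectation (\<lambda>x. \<phi> (S x) * (h x - \<mu>)) = expectation (\<lambda>x. 0)"
      by (intro integral_cong_AE) auto
    then show ?thesis by simp
  next
    case False
    then obtain r where r: "0 \<le> r" "g r < \<mu>" by auto
    (* u is where g crosses the mean of Z; inserting 0 keeps Sup meaningful when g < mean on all of {0..}. *)
    define V where "V = insert 0 {s. 0 \<le> s \<and> \<mu> \<le> g s}"
    define u where "u = Sup V"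
    have Vr: "s \<le> r" if "s \<in> V" for s
      using that r g_anti[of r s] by (cases "s \<le> r") (auto simp: V_def)
    then have bdd: "bdd_above V" by (auto simp: bdd_above_def)
    have "0 \<le> u" unfolding u_def using bdd by (intro cSup_upper) (auto simp: V_def)
    have above: "g s < \<mu>" if "u < s" for s
      using cSup_upper[OF _ bdd, of s] that \<open>0 \<le> u\<close> unfolding u_def[symmetric] by (force simp: V_def)
    have below: "\<mu> \<le> g s" if "0 \<le> s" "s < u" for s
    proof -
      obtain t where "t \<in> V" "s < t" using \<open>s < u\<close> less_cSup_iff[OF _ bdd] by (auto simp: u_def V_def)
      then show ?thesis using g_anti[of s t] that by (auto simp: V_def)
    qed
    \<comment> \<open>The two factors have opposite signs on either side of \<open>u\<close>. At
      \<open>u\<close> itself the first factor vanishes, so the value of \<open>g\<close> there is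
      irrelevant.\<close>
    have "AE x in M. (\<phi> (S x) - \<phi> u) * (h x - \<mu>) \<le> 0"
      using hg
    proof eventually_elim
      case (elim x)
      show ?case
      proof (cases "S x" u rule: linorder_cases)
        case less
        then show ?thesis using below[OF S0 less] monoD[OF mono, of "S x" u] elim
          by (intro mult_nonpos_nonneg) auto
      next
        case greater
        then show ?thesis using above[OF greater] monoD[OF mono, of u "S x"] elim \<mu>0
          by (intro mult_nonneg_nonpos) auto
      qed auto
    qed
    then have "expectation (\<lambda>x. (\<phi> (S x) - \<phi> u) * (h x - \<mu>)) \<le> expectation (\<lambda>x. 0)"
      using i\<phi>h int\<phi> ih by (intro integral_mono_AE) (auto simp: algebra_simps)
    also have "expectation (\<lambda>x. (\<phi> (S x) - \<phi> u) * (h x - \<mu>)) =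
        expectation (\<lambda>x. \<phi> (S x) * (h x - \<mu>) - \<phi> u * (h x - \<mu>))"
      by (simp add: algebra_simps)
    also have "\<dots> = expectation (\<lambda>x. \<phi> (S x) * (h x - \<mu>)) - \<phi> u * expectation (\<lambda>x. h x - \<mu>)"
      using i\<phi>h int\<phi> ih by (subst Bochner_Integration.integral_diff) (auto simp: right_diff_distrib)
    also have "expectation (\<lambda>x. h x - \<mu>) = 0" using ih Eh by (simp add: prob_space)
    finally show ?thesis by simp
  qed
  with eq show ?thesis by (simp add: \<mu>_def)
qed

section \<open>Growth of a centered moment when one square is added\<close>

lemma geometric_tail_le:
  fixes r :: real
  assumes "0 \<le> r" "r \<le> 1 / 2"
  shows "(\<Sum>l=2..m. r ^ l) \<le> 2 * r\<^sup>2"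
proof (cases "2 \<le> m")
  case True
  have "(1 - r) * (\<Sum>l=2..m. r ^ l) = r\<^sup>2 - r ^ Suc m"
    by (rule sum_gp_multiplied[OF True])
  moreover have "0 \<le> r ^ Suc m" using assms by simp
  moreover have "(1 / 2) * (\<Sum>l=2..m. r ^ l) \<le> (1 - r) * (\<Sum>l=2..m. r ^ l)"
    using assms by (intro mult_right_mono sum_nonneg) auto
  ultimately show ?thesis by linarith
qed simp

lemma abs_diff_power_le:
  fixes a b :: real
  assumes "0 \<le> a" "0 \<le> b"
  shows "\<bar>a - b\<bar> ^ l \<le> a ^ l + b ^ l"
proof (cases "a \<le> b")
  case True
  then have "\<bar>a - b\<bar> ^ l \<le> b ^ l" using assms by (intro power_mono) auto
  then show ?thesis using assms by (simp add: add_increasing)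
next
  case False
  then have "\<bar>a - b\<bar> ^ l \<le> a ^ l" using assms by (intro power_mono) auto
  then show ?thesis using assms by (simp add: add_increasing2)
qed

text \<open>In the binomial expansion order 0 gives \<open>B^m\<close>, order 1 is nonpositive, and
  the orders from 2 on are dominated by a geometric series of ratio
  \<open>2 * exp 1 * A * m / B\<close>. The second condition on \<open>B\<close> says that this
  ratio is at most 1/2, which makes the series at most twice its first term.\<close>

lemma (in prob_space) centered_moment_add:
  fixes S Z :: "'a \<Rightarrow> real" and g :: "real \<Rightarrow> real" and A B :: real
  assumes [measurable]: "S \<in> borel_measurable M" "Z \<in> borel_measurable M"
    and S0: "\<And>x. 0 \<le> S x" and Z0: "\<And>x. 0 \<le> Z x"
    and anti: "antimono_on {0..} g"
    and ce: "AE x in M. cond_exp_given M S Z x = ennreal (g (S x))"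
    and m: "even m" "0 < m" and A: "0 \<le> A"
    and mom: "\<And>l. l \<in> {1..m} \<Longrightarrow>
      AE x in M. cond_exp_given M S (\<lambda>x. Z x ^ l) x \<le> ennreal ((A * real l) ^ l)"
    and B: "0 < B" "2 * (2 * exp 1 * A * real m) \<le> B"
    and intS: "integrable M (\<lambda>x. (S x - s) ^ m)"
    and le: "expectation (\<lambda>x. (S x - s) ^ m) \<le> B ^ m"
  shows "integrable M Z"
    and "integrable M (\<lambda>x. (S x + Z x - (s + expectation Z)) ^ m)"
    and "expectation (\<lambda>x. (S x + Z x - (s + expectation Z)) ^ m)
      \<le> B ^ m * (1 + 2 * (2 * exp 1 * A * real m / B)\<^sup>2)"
proof -
  have "(\<lambda>x. (S x - s) ^ m) = (\<lambda>x. \<bar>S x - s\<bar> ^ m)" using m by (simp add: power_even_abs)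
  then have intp: "integrable M (\<lambda>x. \<bar>S x - s\<bar> ^ p)"
    and lep: "expectation (\<lambda>x. \<bar>S x - s\<bar> ^ p) \<le> B ^ p" if "p \<le> m" for p
    using lyapunov_power_bound[of "\<lambda>x. S x - s" m B p] intS le B that by auto
  have mom1: "AE x in M. cond_exp_given M S Z x \<le> ennreal A" using mom[of 1] m by simp
  show intZ: "integrable M Z"
  proof -
    have "integrable M (\<lambda>x. 1 * Z x)"
      by (rule integral_mult_le_of_cond_exp_given_le(1)[where \<phi>="\<lambda>_. 1" and S=S and f=Z and b=A])
        (use Z0 A mom1 in simp_all)
    then show ?thesis by simp
  qed
  define \<mu> where "\<mu> = expectation Z"
  have "0 \<le> \<mu>" unfolding \<mu>_def using Z0 by simp
  have "\<mu> \<le> A"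
  proof -
    have "expectation (\<lambda>x. 1 * Z x) \<le> A * expectation (\<lambda>x. 1)"
      by (rule integral_mult_le_of_cond_exp_given_le(2)[where \<phi>="\<lambda>_. 1" and S=S and f=Z and b=A])
        (use Z0 A mom1 in simp_all)
    then show ?thesis by (simp add: \<mu>_def prob_space)
  qed
  \<comment> \<open>\<open>\<bar>Z - \<mu>\<bar>^l\<close> is at most \<open>Z^l + \<mu>^l\<close>.
    Conditioning handles the first summand and \<open>\<mu> \<le> A\<close> the second, each giving
    \<open>(A l)^l B^(m - l)\<close>; the resulting factor 2 is enlarged to \<open>2^l\<close> to
    sit inside the power.\<close>
  have abs_term: "integrable M (\<lambda>x. \<bar>Z x - \<mu>\<bar> ^ l * \<bar>S x - s\<bar> ^ (m - l)) \<and>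
      expectation (\<lambda>x. \<bar>Z x - \<mu>\<bar> ^ l * \<bar>S x - s\<bar> ^ (m - l)) \<le> (2 * A * real l) ^ l * B ^ (m - l)"
    if l: "l \<in> {1..m}" for l
  proof -
    have c: "0 \<le> (A * real l) ^ l" using A by simp
    have ip: "integrable M (\<lambda>x. \<bar>S x - s\<bar> ^ (m - l))" by (rule intp) simp
    have i1: "integrable M (\<lambda>x. \<bar>S x - s\<bar> ^ (m - l) * Z x ^ l)"
      by (rule integral_mult_le_of_cond_exp_given_le(1)[where \<phi>="\<lambda>t. \<bar>t - s\<bar> ^ (m - l)"
            and S=S and f="\<lambda>x. Z x ^ l" and b="(A * real l) ^ l"])
        (use Z0 c mom[OF l] ip in simp_all)
    have "expectation (\<lambda>x. \<bar>S x - s\<bar> ^ (m - l) * Z x ^ l) \<le> (A * real l) ^ l * expectation (\<lambda>x. \<bar>S x - s\<bar> ^ (m - l))"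
      by (rule integral_mult_le_of_cond_exp_given_le(2)[where \<phi>="\<lambda>t. \<bar>t - s\<bar> ^ (m - l)"
            and S=S and f="\<lambda>x. Z x ^ l" and b="(A * real l) ^ l"])
        (use Z0 c mom[OF l] ip in simp_all)
    also have "\<dots> \<le> (A * real l) ^ l * B ^ (m - l)"
      using c by (intro mult_left_mono lep) auto
    finally have e1: "expectation (\<lambda>x. \<bar>S x - s\<bar> ^ (m - l) * Z x ^ l) \<le> (A * real l) ^ l * B ^ (m - l)" .
    have "\<mu> ^ l \<le> (A * real l) ^ l"
      using \<open>0 \<le> \<mu>\<close> \<open>\<mu> \<le> A\<close> l A by (intro power_mono) (auto intro: order.trans[OF _ mult_left_mono[of 1]])
    then have e2: "\<mu> ^ l * expectation (\<lambda>x. \<bar>S x - s\<bar> ^ (m - l)) \<le> (A * real l) ^ l * B ^ (m - l)"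
      using c by (intro mult_mono lep) auto
    let ?dom = "\<lambda>x. \<bar>S x - s\<bar> ^ (m - l) * Z x ^ l + \<mu> ^ l * \<bar>S x - s\<bar> ^ (m - l)"
    have idom: "integrable M ?dom" using i1 ip by simp
    have pw: "\<bar>Z x - \<mu>\<bar> ^ l * \<bar>S x - s\<bar> ^ (m - l) \<le> ?dom x" for x
      using mult_right_mono[OF abs_diff_power_le[OF Z0 \<open>0 \<le> \<mu>\<close>, of x l], of "\<bar>S x - s\<bar> ^ (m - l)"]
      by (simp add: algebra_simps)
    have i: "integrable M (\<lambda>x. \<bar>Z x - \<mu>\<bar> ^ l * \<bar>S x - s\<bar> ^ (m - l))"
    proof (rule Bochner_Integration.integrable_bound[OF idom])
      have "norm (\<bar>Z x - \<mu>\<bar> ^ l * \<bar>S x - s\<bar> ^ (m - l)) \<le> norm (?dom x)" for x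
        using order.trans[OF pw abs_ge_self, of x] unfolding real_norm_def abs_mult power_abs[symmetric] abs_abs .
      then show "AE x in M. norm (\<bar>Z x - \<mu>\<bar> ^ l * \<bar>S x - s\<bar> ^ (m - l)) \<le> norm (?dom x)" by simp
    qed simp
    have "expectation (\<lambda>x. \<bar>Z x - \<mu>\<bar> ^ l * \<bar>S x - s\<bar> ^ (m - l)) \<le> expectation ?dom"
      by (rule integral_mono[OF i idom pw])
    also have "\<dots> = expectation (\<lambda>x. \<bar>S x - s\<bar> ^ (m - l) * Z x ^ l) + \<mu> ^ l * expectation (\<lambda>x. \<bar>S x - s\<bar> ^ (m - l))"
      using i1 ip by simp
    also have "\<dots> \<le> 2 * ((A * real l) ^ l * B ^ (m - l))" using e1 e2 by simp
    also have "\<dots> \<le> 2 ^ l * ((A * real l) ^ l * B ^ (m - l))"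
      using l c B by (intro mult_right_mono) (auto intro: self_le_power)
    also have "\<dots> = (2 * A * real l) ^ l * B ^ (m - l)" by (simp add: power_mult_distrib)
    finally show ?thesis using i by simp
  qed
  define X where "X = (\<lambda>l x. (Z x - \<mu>) ^ l * (S x - s) ^ (m - l))"
  have absX: "\<bar>X l x\<bar> = \<bar>Z x - \<mu>\<bar> ^ l * \<bar>S x - s\<bar> ^ (m - l)" for l x
    by (simp add: X_def abs_mult power_abs)
  have Xmeas[measurable]: "X l \<in> borel_measurable M" for l unfolding X_def by measurable
  have iX: "integrable M (X l)" if "l \<le> m" for l
  proof (cases "l = 0")
    case True
    then show ?thesis using intS by (simp add: X_def)
  next
    case False
    then have "integrable M (\<lambda>x. \<bar>X l x\<bar>)" unfolding absX using abs_term[of l] that by simp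
    then show ?thesis by (rule integrable_abs_cancel) simp
  qed
  have expand: "(S x + Z x - (s + \<mu>)) ^ m = (\<Sum>l\<le>m. real (m choose l) * X l x)" for x
  proof -
    have "S x + Z x - (s + \<mu>) = (Z x - \<mu>) + (S x - s)" by simp
    then show ?thesis unfolding X_def using binomial_ring[of "Z x - \<mu>" "S x - s" m]
      by (simp only: mult.assoc)
  qed
  show "integrable M (\<lambda>x. (S x + Z x - (s + expectation Z)) ^ m)"
    unfolding \<mu>_def[symmetric] expand using iX by auto
  \<comment> \<open>The factor 2 comes from centering \<open>Z\<close>, and \<open>exp 1 * m\<close>
    from \<open>binomial_mult_power_self_le\<close>.\<close>
  define Q where "Q = 2 * exp 1 * A * real m"
  have Q0: "0 \<le> Q" using A by (simp add: Q_def)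
  have EX0: "expectation (X 0) \<le> B ^ m" using le by (simp add: X_def)
  have EX1: "expectation (X 1) \<le> 0"
  proof -
    \<comment> \<open>Since \<open>m\<close> is even, \<open>(t - s)^(m - 1)\<close> is monotone on
      the whole line, as the association inequality requires.\<close>
    have odd: "odd (m - 1)" using m by simp
    have im: "integrable M (\<lambda>x. (S x - s) ^ (m - 1))"
      by (rule integrable_abs_cancel) (use intp[of "m - 1"] in \<open>simp_all add: power_abs\<close>)
    \<comment> \<open>Adding the centering term back to \<open>X 1\<close> recovers the uncentered
      product with \<open>Z\<close>.\<close>
    have "integrable M (\<lambda>x. X 1 x + \<mu> * (S x - s) ^ (m - 1))"
      using iX[of 1] im m by simp
    then have iZ: "integrable M (\<lambda>x. (S x - s) ^ (m - 1) * Z x)"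
      by (simp add: X_def algebra_simps)
    have "mono (\<lambda>t. (t - s) ^ (m - 1))" using odd by (auto intro!: monoI power_mono_odd)
    then have "expectation (\<lambda>x. (S x - s) ^ (m - 1) * (Z x - expectation Z)) \<le> 0"
      by (rule expectation_mult_centered_nonpos[where \<phi>="\<lambda>t. (t - s) ^ (m - 1)" and S=S and Z=Z and g=g,
            rotated 3, OF S0 Z0 anti ce _ intZ im iZ]) simp_all
    then show ?thesis by (simp add: X_def \<mu>_def mult.commute)
  qed
  have EXl: "real (m choose l) * expectation (X l) \<le> B ^ m * (Q / B) ^ l" if "l \<in> {2..m}" for l
  proof -
    have l: "l \<in> {1..m}" using that by simp
    have "expectation (X l) \<le> expectation (\<lambda>x. \<bar>X l x\<bar>)"
      using iX[of l] l by (intro integral_mono) auto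
    also have "\<dots> \<le> (2 * A * real l) ^ l * B ^ (m - l)"
      unfolding absX using abs_term[OF l] by simp
    finally have "real (m choose l) * expectation (X l) \<le> real (m choose l) * ((2 * A * real l) ^ l * B ^ (m - l))"
      by (intro mult_left_mono) auto
    also have "\<dots> = (real (m choose l) * real l ^ l) * ((2 * A) ^ l * B ^ (m - l))"
      by (simp add: power_mult_distrib)
    also have "\<dots> \<le> (exp 1 * real m) ^ l * ((2 * A) ^ l * B ^ (m - l))"
      using l A B by (intro mult_right_mono binomial_mult_power_self_le) auto
    also have "\<dots> = Q ^ l * B ^ (m - l)"
      by (simp add: Q_def power_mult_distrib)
    also have "\<dots> = B ^ m * (Q / B) ^ l"
      using l B by (simp add: power_diff power_divide)
    finally show ?thesis .
  qed
  have "expectation (\<lambda>x. (S x + Z x - (s + \<mu>)) ^ m) = (\<Sum>l\<le>m. real (m choose l) * expectation (X l))"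
    unfolding expand using iX by (subst Bochner_Integration.integral_sum) auto
  also have "{..m} = insert 0 (insert 1 {2..m})" using m by auto
  also have "(\<Sum>l\<in>\<dots>. real (m choose l) * expectation (X l)) =
      expectation (X 0) + real m * expectation (X 1) + (\<Sum>l=2..m. real (m choose l) * expectation (X l))"
    by simp
  also have "\<dots> \<le> B ^ m + 0 + (\<Sum>l=2..m. B ^ m * (Q / B) ^ l)"
    using EX0 EX1 EXl by (intro add_mono sum_mono) (auto intro: mult_nonneg_nonpos)
  also have "\<dots> = B ^ m * (1 + (\<Sum>l=2..m. (Q / B) ^ l))"
    by (simp add: sum_distrib_left distrib_left)
  also have "\<dots> \<le> B ^ m * (1 + 2 * (Q / B)\<^sup>2)"
    using B Q0 by (intro mult_left_mono add_left_mono geometric_tail_le) (auto simp: Q_def field_simps)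
  finally show "expectation (\<lambda>x. (S x + Z x - (s + expectation Z)) ^ m)
      \<le> B ^ m * (1 + 2 * (2 * exp 1 * A * real m / B)\<^sup>2)"
    unfolding \<mu>_def Q_def .
qed

section \<open>Induction over the partial sums\<close>

text \<open>The bound carries \<open>k + j\<close> instead of \<open>j\<close>: this slack, present
  already for the empty sum, keeps the geometric ratio at most 1/2 in every step, while each step
  only raises \<open>k + j\<close> by 1.\<close>

lemma (in prob_space) centered_moment_partial_sq_sum:
  fixes Y :: "nat \<Rightarrow> 'a \<Rightarrow> real" and A :: real
  assumes meas: "\<And>i. i \<in> {1..k} \<Longrightarrow> Y i \<in> borel_measurable M"
    and noninc: "\<And>i. i \<in> {1..k} \<Longrightarrow> cond_sq_nonincreasing M Y i"
    and p: "0 < p" "2 * p \<le> k" and A: "0 < A"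
    and mom: "\<And>i l. i \<in> {1..k} \<Longrightarrow> l \<in> {1..2 * p} \<Longrightarrow>
      AE x in M. cond_exp_given M (partial_sq_sum Y i) (\<lambda>x. Y i x ^ (2 * l)) x \<le> ennreal ((A * real l) ^ l)"
    and "j \<le> k"
  defines "S \<equiv> \<lambda>j. partial_sq_sum Y (Suc j)"
  shows "integrable M (S j) \<and> integrable M (\<lambda>x. (S j x - expectation (S j)) ^ (2 * p)) \<and>
    expectation (\<lambda>x. (S j x - expectation (S j)) ^ (2 * p))
      \<le> (32 * (exp 1)\<^sup>2 * A\<^sup>2 * real p * (real k + real j)) ^ p"
  using \<open>j \<le> k\<close>
proof (induction j)
  case 0
  have "S 0 = (\<lambda>_. 0)" by (auto simp: S_def partial_sq_sum_def)
  then show ?case using p A by (simp add: power_0_left)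
next
  case (Suc j)
  then have i: "Suc j \<in> {1..k}" by simp
  define Z where "Z = (\<lambda>x. (Y (Suc j) x)\<^sup>2)"
  have S_Suc: "S (Suc j) = (\<lambda>x. S j x + Z x)"
    by (auto simp: S_def Z_def partial_sq_sum_def)
  have [measurable]: "S j \<in> borel_measurable M" "Z \<in> borel_measurable M"
    unfolding S_def Z_def partial_sq_sum_def using meas Suc.prems
    by (auto intro!: borel_measurable_sum borel_measurable_power simp del: sum.op_ivl_Suc)
  obtain g where anti: "antimono_on {0..} g"
    and ce: "AE x in M. cond_exp_given M (S j) Z x = ennreal (g (S j x))"
    using noninc[OF i] unfolding cond_sq_nonincreasing_def S_def Z_def by blast
  define W where "W = 32 * (exp 1)\<^sup>2 * A\<^sup>2 * real p * (real k + real j)"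
  define B where "B = sqrt W"
  define Q where "Q = 2 * exp 1 * A * real (2 * p)"
  have W: "0 < W" using p A by (simp add: W_def)
  have Bp: "B ^ (2 * p) = W ^ p" using W by (simp add: B_def power_mult)
  \<comment> \<open>The left side is \<open>64 * (exp 1)\<^sup>2 * A\<^sup>2 * p\<^sup>2\<close>, so
    the constant 32 together with \<open>2 * p \<le> k\<close> suffices.\<close>
  have QW: "(2 * Q)\<^sup>2 \<le> W"
  proof -
    have "(2 * Q)\<^sup>2 = 32 * (exp 1)\<^sup>2 * A\<^sup>2 * real p * (2 * real p)"
      by (simp add: Q_def power2_eq_square)
    also have "\<dots> \<le> W" unfolding W_def using p by (intro mult_left_mono) auto
    finally show ?thesis .
  qed
  have QB: "2 * Q \<le> B" unfolding B_def by (rule real_le_rsqrt) (rule QW)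
  have B0: "0 < B" using W by (simp add: B_def)
  \<comment> \<open>The power \<open>l\<close> of \<open>Z\<close> is the power \<open>2 * l\<close>
    of \<open>Y\<close>, so order \<open>2 * p\<close> here uses moments of \<open>Y\<close> up to
    order \<open>4 * p\<close>.\<close>
  have mom': "AE x in M. cond_exp_given M (S j) (\<lambda>x. Z x ^ l) x \<le> ennreal ((A * real l) ^ l)"
    if "l \<in> {1..2 * p}" for l
    using mom[OF i that] by (simp add: S_def Z_def power_mult)
  have IH: "integrable M (S j)" "integrable M (\<lambda>x. (S j x - expectation (S j)) ^ (2 * p))"
    "expectation (\<lambda>x. (S j x - expectation (S j)) ^ (2 * p)) \<le> B ^ (2 * p)"
    using Suc unfolding Bp W_def by auto
  have S0: "0 \<le> S j x" and Z0: "0 \<le> Z x" for x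
    by (auto simp: S_def Z_def partial_sq_sum_def simp del: sum.op_ivl_Suc intro: sum_nonneg)
  have "0 < 2 * p" "even (2 * p)" "0 \<le> A" using p A by auto
  note step = centered_moment_add[where S="S j" and Z=Z and g=g and m="2 * p" and A=A and B=B
      and s="expectation (S j)", OF _ _ S0 Z0 anti ce this(2,1,3) mom' B0 QB[unfolded Q_def] IH(2,3), folded Q_def]
  have intZ: "integrable M Z" by (rule step(1)) simp_all
  have E: "expectation (S (Suc j)) = expectation (S j) + expectation Z"
    unfolding S_Suc using IH(1) intZ by simp
  have int: "integrable M (\<lambda>x. (S (Suc j) x - expectation (S (Suc j))) ^ (2 * p))"
    unfolding E unfolding S_Suc by (rule step(2)) simp_all
  have "expectation (\<lambda>x. (S (Suc j) x - expectation (S (Suc j))) ^ (2 * p)) \<le> B ^ (2 * p) * (1 + 2 * (Q / B)\<^sup>2)"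
    unfolding E unfolding S_Suc by (rule step(3)) simp_all
  also have "2 * (Q / B)\<^sup>2 = real p / (real k + real j)"
  proof -
    have "2 * (Q / B)\<^sup>2 = 2 * Q\<^sup>2 / W" using W by (simp add: B_def power_divide)
    also have "2 * Q\<^sup>2 = (32 * (exp 1)\<^sup>2 * A\<^sup>2 * real p) * real p"
      by (simp add: Q_def power2_eq_square)
    also have "\<dots> / W = real p / (real k + real j)"
      unfolding W_def using p A by (subst mult_divide_mult_cancel_left) auto
    finally show ?thesis .
  qed
  \<comment> \<open>Bernoulli's inequality puts the growth factor inside the power \<open>p\<close>,
    where it changes \<open>k + j\<close> into \<open>k + j + 1\<close>.\<close>
  also have "B ^ (2 * p) * (1 + real p / (real k + real j)) \<le> W ^ p * (1 + 1 / (real k + real j)) ^ p"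
  proof -
    have "- 1 \<le> 1 / (real k + real j)" by (rule order.trans[of _ 0]) auto
    then show ?thesis
      unfolding Bp using W Bernoulli_inequality[of "1 / (real k + real j)" p]
      by (intro mult_left_mono) auto
  qed
  also have "\<dots> = (W * (1 + 1 / (real k + real j))) ^ p" by (simp add: power_mult_distrib)
  also have "W * (1 + 1 / (real k + real j)) = 32 * (exp 1)\<^sup>2 * A\<^sup>2 * real p * (real k + real (Suc j))"
    using p by (simp add: W_def field_simps)
  finally show ?case using int IH(1) intZ by (simp add: S_Suc)
qed

section \<open>From moments to the tail bound\<close>

lemma (in prob_space) prob_deviation_le_moment:
  fixes X :: "'a \<Rightarrow> real"
  assumes [measurable]: "X \<in> borel_measurable M"
    and int: "integrable M (\<lambda>x. (X x - a) ^ (2 * p))" and "0 < t"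
  shows "prob {x \<in> space M. t \<le> \<bar>X x - a\<bar>} \<le> expectation (\<lambda>x. (X x - a) ^ (2 * p)) / t ^ (2 * p)"
proof -
  have "{x \<in> space M. t \<le> \<bar>X x - a\<bar>} \<subseteq> {x \<in> space M. t ^ (2 * p) \<le> (X x - a) ^ (2 * p)}"
  proof clarify
    fix x assume "t \<le> \<bar>X x - a\<bar>"
    then have "t ^ (2 * p) \<le> \<bar>X x - a\<bar> ^ (2 * p)" using \<open>0 < t\<close> by (intro power_mono) auto
    then show "t ^ (2 * p) \<le> (X x - a) ^ (2 * p)" by (simp add: power_even_abs)
  qed
  then have "prob {x \<in> space M. t \<le> \<bar>X x - a\<bar>} \<le> prob {x \<in> space M. t ^ (2 * p) \<le> (X x - a) ^ (2 * p)}"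
    by (intro finite_measure_mono) measurable
  also have "\<dots> \<le> expectation (\<lambda>x. (X x - a) ^ (2 * p)) / t ^ (2 * p)"
    using \<open>0 < t\<close> by (intro integral_Markov_inequality_measure[OF int, of "{}"]) auto
  finally show ?thesis .
qed

theorem theorem6:
  fixes c :: real
  assumes "c > 0"
  shows "\<exists>c\<^sub>0 > 0. \<exists>c\<^sub>0' > 0. \<forall>(n::nat) (k::nat) (D :: (nat \<Rightarrow> real) measure) (Y :: nat \<Rightarrow> (nat \<Rightarrow> real) \<Rightarrow> real).
           1 \<le> k \<longrightarrow> k \<le> n \<longrightarrow>
           prob_space D \<longrightarrow>
           sets D = sets (\<Pi>\<^sub>M i\<in>{1..n}. (borel :: real measure)) \<longrightarrow>
           Y = (\<lambda>i y. y i) \<longrightarrow>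
           (\<forall>i\<in>{1..k}. cond_sq_nonincreasing D Y i) \<longrightarrow>
           (\<forall>i\<in>{1..k}. \<forall>l\<in>{1..k}. even l \<longrightarrow>
              (AE y in D. cond_exp_given D (partial_sq_sum Y i) (\<lambda>y. Y i y ^ l) y
                            \<le> ennreal ((c * real l) ^ (l div 2) / real n ^ (l div 2)))) \<longrightarrow>
           has_normal_tails c\<^sub>0 c\<^sub>0' D (\<lambda>y. \<Sum>i\<in>{1..k}. (Y i y)\<^sup>2) (real k / (real n)\<^sup>2) (real k / real n)"
proof -
  \<comment> \<open>The entry 256 is the constant of the final moment bound,
    \<open>32 * 4 * 2\<close> with \<open>A = 2 * c / n\<close> and \<open>j = k\<close>. The entry
    2 ensures \<open>exp 1 * E \<ge> 4\<close>, which keeps the moment order within reach of the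
    hypothesis. Only \<open>c\<close> enters, so the constants are uniform in \<open>n\<close> and
    \<open>k\<close>.\<close>
  define E where "E = max 2 (256 * (exp 1)\<^sup>2 * c\<^sup>2)"
  have E: "2 \<le> E" "256 * (exp 1)\<^sup>2 * c\<^sup>2 \<le> E" unfolding E_def by auto
  have e2: "(2::real) \<le> exp 1" using exp_ge_add_one_self[of 1] by simp
  have eE: "4 \<le> exp 1 * E" using mult_mono[OF e2 E(1)] by simp
  have tails: "has_normal_tails (1 / (exp 1 * E)) (exp 1) D (\<lambda>y. \<Sum>i\<in>{1..k}. (Y i y)\<^sup>2) (real k / (real n)\<^sup>2) (real k / real n)"
    if k: "1 \<le> k" "k \<le> n" and D: "prob_space D"
      and sets: "sets D = sets (\<Pi>\<^sub>M i\<in>{1..n}. (borel :: real measure))"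
      and Y: "Y = (\<lambda>i y. y i)"
      and noninc: "\<forall>i\<in>{1..k}. cond_sq_nonincreasing D Y i"
      and mom: "\<forall>i\<in>{1..k}. \<forall>l\<in>{1..k}. even l \<longrightarrow>
              (AE y in D. cond_exp_given D (partial_sq_sum Y i) (\<lambda>y. Y i y ^ l) y
                            \<le> ennreal ((c * real l) ^ (l div 2) / real n ^ (l div 2)))"
    for n k :: nat and D :: "(nat \<Rightarrow> real) measure" and Y
    unfolding has_normal_tails_def
  proof (intro ballI)
    fix t assume t: "t \<in> {0..real k / real n}"
    interpret prob_space D by fact
    define X where "X = (\<lambda>y. \<Sum>i\<in>{1..k}. (Y i y)\<^sup>2)"
    have X_eq: "X = partial_sq_sum Y (Suc k)"
      by (auto simp: X_def partial_sq_sum_def atLeastLessThanSuc_atLeastAtMost)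
    have meas: "Y i \<in> borel_measurable D" if "i \<in> {1..k}" for i
      unfolding Y measurable_cong_sets[OF sets refl] using that k
      by (intro measurable_component_singleton) auto
    have [measurable]: "X \<in> borel_measurable D" unfolding X_def using meas by auto
    define r where "r = t\<^sup>2 * (real n)\<^sup>2 / real k"
    \<comment> \<open>Here the range \<open>t \<le> k / n\<close> enters: it gives
      \<open>r \<le> k\<close>, and so limits the moment order by \<open>k\<close>.\<close>
    have "(t * real n)\<^sup>2 \<le> (real k)\<^sup>2" using t k by (intro power_mono) (auto simp: field_simps)
    then have r: "r \<le> real k" using k by (simp add: r_def power2_eq_square field_simps)
    have r_nonneg: "0 \<le> r" by (simp add: r_def)
    \<comment> \<open>The largest order for which the base
      \<open>256 * (exp 1)\<^sup>2 * c\<^sup>2 * p / r\<close> of the Markov bound is guaranteed,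
      through \<open>E\<close>, to be at most \<open>exp (-1)\<close>. If it is 0, the bound to
      prove is the trivial 1.\<close>
    define p where "p = nat \<lfloor>r / (exp 1 * E)\<rfloor>"
    have p_le: "real p \<le> r / (exp 1 * E)" and p_gt: "r / (exp 1 * E) - 1 < real p"
      using r_nonneg E unfolding p_def by (auto simp: of_nat_floor)
    have "prob {y \<in> space D. t \<le> \<bar>X y - expectation X\<bar>} \<le> exp (- real p)"
    proof (cases "p = 0")
      case True then show ?thesis by simp
    next
      case False
      have pr: "real p * (exp 1 * E) \<le> r" using p_le E by (simp add: field_simps)
      have "real p * 4 \<le> real p * (exp 1 * E)" using eE by (intro mult_left_mono) auto
      then have "real (4 * p) \<le> real k" using pr r by simp
      then have p4: "4 * p \<le> k" by (simp only: of_nat_le_iff)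
      have r0: "0 < r" using pr False E by (auto intro: less_le_trans[rotated])
      then have t0: "0 < t" using t by (cases "t = 0") (auto simp: r_def)
      \<comment> \<open>The factor 2 absorbs the doubled index:
        \<open>(c * 2 l)^l / n^l = (A l)^l\<close>.\<close>
      define A where "A = 2 * c / real n"
      have A0: "0 < A" using assms k by (simp add: A_def)
      have momA: "AE y in D. cond_exp_given D (partial_sq_sum Y i) (\<lambda>y. Y i y ^ (2 * l)) y \<le> ennreal ((A * real l) ^ l)"
        if "i \<in> {1..k}" "l \<in> {1..2 * p}" for i l
      proof -
        have "2 * l \<in> {1..k}" using that p4 by auto
        moreover have "(c * real (2 * l)) ^ l / real n ^ l = (A * real l) ^ l"
          by (simp add: A_def power_divide[symmetric] field_simps)
        ultimately show ?thesis using mom that by fastforce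
      qed
      have bound: "integrable D X \<and> integrable D (\<lambda>x. (X x - expectation X) ^ (2 * p)) \<and>
        expectation (\<lambda>x. (X x - expectation X) ^ (2 * p))
          \<le> (32 * (exp 1)\<^sup>2 * A\<^sup>2 * real p * (real k + real k)) ^ p"
        unfolding X_eq using meas noninc False p4 A0 momA
        by (intro centered_moment_partial_sq_sum[where k=k]) auto
      have "prob {y \<in> space D. t \<le> \<bar>X y - expectation X\<bar>}
          \<le> expectation (\<lambda>x. (X x - expectation X) ^ (2 * p)) / t ^ (2 * p)"
        using bound t0 by (intro prob_deviation_le_moment) auto
      also have "\<dots> \<le> (32 * (exp 1)\<^sup>2 * A\<^sup>2 * real p * (real k + real k)) ^ p / t ^ (2 * p)"
        using bound t0 by (intro divide_right_mono) auto
      also have "\<dots> = (256 * (exp 1)\<^sup>2 * c\<^sup>2 * real p / r) ^ p"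
      proof -
        have "32 * (exp 1)\<^sup>2 * A\<^sup>2 * real p * (real k + real k) / t\<^sup>2 = 256 * (exp 1)\<^sup>2 * c\<^sup>2 * real p / r"
          using k t0 by (simp add: A_def r_def power2_eq_square field_simps)
        then show ?thesis unfolding power_mult power_divide[symmetric] by (rule arg_cong)
      qed
      also have "\<dots> \<le> (exp (-1)) ^ p"
      proof (rule power_mono)
        have "256 * (exp 1)\<^sup>2 * c\<^sup>2 * real p \<le> E * real p" using E by (intro mult_right_mono) auto
        also have "\<dots> \<le> exp (-1) * r" using pr by (simp add: exp_minus field_simps)
        finally show "256 * (exp 1)\<^sup>2 * c\<^sup>2 * real p / r \<le> exp (-1)" using r0 by (simp add: field_simps)
      qed (use r0 in auto)
      also have "\<dots> = exp (- real p)" by (simp add: exp_of_nat_mult[symmetric])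
      finally show ?thesis .
    qed
    \<comment> \<open>Rounding down costs less than 1 in the exponent, hence the prefactor
      \<open>exp 1\<close>.\<close>
    also have "\<dots> \<le> exp (1 - r / (exp 1 * E))" using p_gt by simp
    also have "\<dots> = exp 1 * exp (- (1 / (exp 1 * E)) * t\<^sup>2 / (real k / (real n)\<^sup>2))"
      by (simp add: r_def exp_add[symmetric] mult.commute)
    finally show "prob {y \<in> space D. t \<le> \<bar>(\<Sum>i\<in>{1..k}. (Y i y)\<^sup>2) - expectation (\<lambda>y. \<Sum>i\<in>{1..k}. (Y i y)\<^sup>2)\<bar>}
        \<le> exp 1 * exp (- (1 / (exp 1 * E)) * t\<^sup>2 / (real k / (real n)\<^sup>2))"
      unfolding X_def .
  qed
  have "0 < 1 / (exp 1 * E)" "(0::real) < exp 1" using E by auto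
  with tails show ?thesis
    by (intro exI[of _ "1 / (exp 1 * E)"] exI[of _ "exp 1"] conjI allI impI) assumption+
qed

end
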